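(* Let $(x^k)_{k\in\mathbb{N}}$ and $(\alpha_k)_{k\in\mathbb{N}}$ be the sequences generated by Method 1. Suppose that $S_*\neq\emptyset$ and that there exists $\alpha>0$ such that $\alpha_k\ge\alpha$ for all $k\in\mathbb{N}$. Then $$(f+g)(x^k)-\min_{x\in\mathcal{H}}(f+g)(x)\le\frac{1}{2\alpha}\,\frac{[\operatorname{dist}(x^0,S_* )]^2}{k}\qquad\text{for all integers } k\ge 1.$$ If in addition $\dim\mathcal{H}<+\infty$, then $$\lim_{k\to\infty}k\Big[(f+g)(x^k)-\min_{x\in\mathcal{H}}(f+g)(x)\Big]=0.$$
   Context: Let $\mathcal{H}$ be a real Hilbert space with inner product $\langle\cdot,\cdot\rangle$ and induced norm $\|\cdot\|$; $\overline{\mathbb{R}}:=\mathbb{R}\cup\{+\infty\}$ and $\operatorname{dom}h:=\{x\in\mathcal{H}: h(x)<+\infty\}$. Standing assumptions. (A1) $f,g:\mathcal{H}\to\overline{\mathbb{R}}$ are proper lower semicontinuous convex functions with $\operatorname{dom}g\subseteq\operatorname{dom}f$. (A2) $f$ is Fréchet differentiable on an open set containing $\operatorname{dom}g$; its gradient $\nabla f$ is uniformly continuous on any bounded subset of $\operatorname{dom}g$ and maps any bounded subset of $\operatorname{dom}g$ to a bounded set in $\mathcal{H}$. $S_*$ denotes the set of minimizers of $f+g$ over $\mathcal{H}$, and $\operatorname{dist}(x,S):=\inf_{y\in S}\|x-y\|$. The proximal operator is $\operatorname{prox}_{\alpha g}:=(\mathrm{Id}+\alpha\,\partial g)^{-1}$,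 which is single-valued and defined on all of $\mathcal{H}$ with values in $\operatorname{dom}g$. For $x\in\operatorname{dom}g$ and $\alpha>0$, $J(x,\alpha):=\operatorname{prox}_{\alpha g}(x-\alpha\nabla f(x))$. Linesearch 1 $(x,\sigma,\theta,\delta)$, for $x\in\operatorname{dom}g$, $\sigma>0$, $\theta\in(0,1)$, $\delta\in(0,1/2)$: set $\alpha=\sigma$; while $\alpha\|\nabla f(J(x,\alpha))-\nabla f(x)\|>\delta\|J(x,\alpha)-x\|$, replace $\alpha$ by $\theta\alpha$; output $\alpha$. Method 1: choose $x^0\in\operatorname{dom}g$, $\sigma>0$, $\theta\in(0,1)$, $\delta\in(0,1/2)$. For $k=0,1,2,\dots$ let $\alpha_k$ be the output of Linesearch 1 $(x^k,\sigma,\theta,\delta)$ and set $x^{k+1}=J(x^k,\alpha_k)$; the stop criterion is $x^{k+1}=x^k$. The statement concerns the infinite sequences $(x^k)_{k\in\mathbb{N}}$, $(\alpha_k)_{k\in\mathbb{N}}$ so generated. *)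

theory Defs
  imports "HOL-Analysis.Analysis" "HOL-Library.While_Combinator"
begin

text \<open>
  A real Hilbert space is a type of sort \<open>{real_inner, complete_space}\<close>.  Functions with values in
  the reals extended by \<open>+\<infinity>\<close> are \<open>ereal\<close>-valued functions that avoid \<open>-\<infinity>\<close>; the latter
  condition is part of \<open>proper\<close>.
\<close>

definition dom :: "('a \<Rightarrow> ereal) \<Rightarrow> 'a set" where
  "dom h = {x. h x < \<infinity>}"

definition proper :: "('a \<Rightarrow> ereal) \<Rightarrow> bool" where
  "proper h \<longleftrightarrow> (\<forall>x. h x \<noteq> -\<infinity>) \<and> dom h \<noteq> {}"

definition lower_semicontinuous :: "('a::topological_space \<Rightarrow> ereal) \<Rightarrow> bool" where
  "lower_semicontinuous h \<longleftrightarrow> (\<forall>x. h x \<le> Liminf (at x) h)"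

definition convex_fun :: "('a::real_vector \<Rightarrow> ereal) \<Rightarrow> bool" where
  "convex_fun h \<longleftrightarrow> (\<forall>x y. \<forall>t::real. 0 < t \<and> t < 1 \<longrightarrow>
     h ((1 - t) *\<^sub>R x + t *\<^sub>R y) \<le> ereal (1 - t) * h x + ereal t * h y)"

text \<open>
  The gradient is meaningful only at interior points of the domain at which the real-valued version
  of the function is Frechet differentiable; existence of the representing vector is then the Riesz
  representation theorem.
\<close>

definition grad :: "('a::real_inner \<Rightarrow> ereal) \<Rightarrow> 'a \<Rightarrow> 'a" where
  "grad h x = (THE D. GDERIV (\<lambda>y. real_of_ereal (h y)) x :> D)"

text \<open>
  A function that is Frechet differentiable on \<open>U\<close> is in particular finite on \<open>U\<close>.  This has to be
  demanded separately, since \<open>real_of_ereal\<close> maps \<open>\<infinity>\<close> to \<open>0\<close>.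
\<close>

definition frechet_differentiable_on :: "('a::real_inner \<Rightarrow> ereal) \<Rightarrow> 'a set \<Rightarrow> bool" where
  "frechet_differentiable_on h U \<longleftrightarrow>
     (\<forall>x\<in>U. \<bar>h x\<bar> \<noteq> \<infinity> \<and> (\<lambda>y. real_of_ereal (h y)) differentiable (at x))"

definition assumption_A1 :: "('a::real_inner \<Rightarrow> ereal) \<Rightarrow> ('a \<Rightarrow> ereal) \<Rightarrow> bool" where
  "assumption_A1 f g \<longleftrightarrow>
     proper f \<and> lower_semicontinuous f \<and> convex_fun f \<and>
     proper g \<and> lower_semicontinuous g \<and> convex_fun g \<and>
     dom g \<subseteq> dom f"

definition assumption_A2 :: "('a::real_inner \<Rightarrow> ereal) \<Rightarrow> ('a \<Rightarrow> ereal) \<Rightarrow> bool" where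
  "assumption_A2 f g \<longleftrightarrow>
     (\<exists>U. open U \<and> dom g \<subseteq> U \<and> frechet_differentiable_on f U) \<and>
     (\<forall>B. B \<subseteq> dom g \<and> bounded B \<longrightarrow>
        uniformly_continuous_on B (grad f) \<and> bounded (grad f ` B))"

definition minimizers :: "('a \<Rightarrow> ereal) \<Rightarrow> 'a set" where
  "minimizers h = {x. \<forall>y. h x \<le> h y}"

definition subdifferential :: "('a::real_inner \<Rightarrow> ereal) \<Rightarrow> 'a \<Rightarrow> 'a set" where
  "subdifferential h x = {v. \<forall>y. h x + ereal (inner v (y - x)) \<le> h y}"

text \<open>
  The resolvent \<open>(Id + \<alpha> \<partial>h)\<^sup>-\<^sup>1\<close>, read as a single-valued map: \<open>prox \<alpha> h x\<close> is the unique \<open>z\<close>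
  with \<open>x \<in> z + \<alpha> \<partial>h(z)\<close>.
\<close>

definition prox :: "real \<Rightarrow> ('a::real_inner \<Rightarrow> ereal) \<Rightarrow> 'a \<Rightarrow> 'a" where
  "prox \<alpha> h x = (THE z. x \<in> (\<lambda>v. z + \<alpha> *\<^sub>R v) ` subdifferential h z)"

definition J :: "('a::real_inner \<Rightarrow> ereal) \<Rightarrow> ('a \<Rightarrow> ereal) \<Rightarrow> 'a \<Rightarrow> real \<Rightarrow> 'a" where
  "J f g x \<alpha> = prox \<alpha> g (x - \<alpha> *\<^sub>R grad f x)"

text \<open>
  The result is \<open>None\<close> precisely if the loop of the linesearch does not terminate.
\<close>

definition linesearch1 ::
  "('a::real_inner \<Rightarrow> ereal) \<Rightarrow> ('a \<Rightarrow> ereal) \<Rightarrow> 'a \<Rightarrow> real \<Rightarrow> real \<Rightarrow> real \<Rightarrow> real option" where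
  "linesearch1 f g x \<sigma> \<theta> \<delta> =
     while_option
       (\<lambda>\<alpha>. \<alpha> * norm (grad f (J f g x \<alpha>) - grad f x) > \<delta> * norm (J f g x \<alpha> - x))
       (\<lambda>\<alpha>. \<theta> * \<alpha>) \<sigma>"

text \<open>
  If the stop criterion \<open>x (Suc k) = x k\<close> is met, the recursion merely stays constant from there on,
  so infinite sequences with and without eventual stopping are both covered.
\<close>

definition method1 ::
  "('a::real_inner \<Rightarrow> ereal) \<Rightarrow> ('a \<Rightarrow> ereal) \<Rightarrow> real \<Rightarrow> real \<Rightarrow> real \<Rightarrow>
   (nat \<Rightarrow> 'a) \<Rightarrow> (nat \<Rightarrow> real) \<Rightarrow> bool" where
  "method1 f g \<sigma> \<theta> \<delta> x \<alpha> \<longleftrightarrow>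
     x 0 \<in> dom g \<and>
     (\<forall>k. linesearch1 f g (x k) \<sigma> \<theta> \<delta> = Some (\<alpha> k) \<and> x (Suc k) = J f g (x k) (\<alpha> k))"

end

theory Submission
  imports Defs
begin

text \<open>
  Write \<open>F = f + g\<close>.  Adding the subgradient inequality for \<open>g\<close> at \<open>x (k + 1)\<close> to the gradient
  inequalities for \<open>f\<close> at \<open>x k\<close> and \<open>x (k + 1)\<close>, and absorbing the gradient difference by the
  stopping test of the linesearch, gives for every \<open>y \<in> dom g\<close>
  \<open>2 \<alpha>\<^sub>k (F (x (k + 1)) - F y) \<le> \<parallel>x k - y\<parallel>\<^sup>2 - \<parallel>x (k + 1) - y\<parallel>\<^sup>2 - (1 - 2 \<delta>) \<parallel>x (k + 1) - x k\<parallel>\<^sup>2\<close>.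
  With \<open>y = x k\<close> the values \<open>F (x k)\<close> decrease; with \<open>y\<close> a minimizer the estimate telescopes.  The
  gaps \<open>F (x k) - min F\<close> are therefore decreasing and summable, so that \<open>k\<close> times the \<open>k\<close>-th gap
  tends to \<open>0\<close>.
\<close>

section \<open>Lower semicontinuous convex functions with extended real values\<close>

text \<open>\<open>Liminf (at x)\<close> ignores the point \<open>x\<close>; the hypothesis
  \<open>c < h x\<close> restores it, which gives a full neighbourhood.\<close>

lemma lower_semicontinuous_nhds:
  assumes "lower_semicontinuous h" "c < h x"
  shows "\<forall>\<^sub>F y in nhds x. c < h y"
proof -
  from assms have "c < Liminf (at x) h"
    unfolding lower_semicontinuous_def by (meson less_le_trans)
  then have "\<forall>\<^sub>F y in at x. c < h y"
    by (rule less_LiminfD)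
  with assms(2) show ?thesis
    unfolding eventually_at_filter by (auto elim!: eventually_mono)
qed

lemma proper_real:
  assumes "proper h" "x \<in> dom h"
  shows "h x = ereal (real_of_ereal (h x))"
  using assms unfolding proper_def dom_def by (cases "h x") auto

lemma convex_fun_real:
  fixes h :: "'a::real_vector \<Rightarrow> ereal"
  assumes "proper h" "convex_fun h" "x \<in> dom h" "y \<in> dom h" "0 < t" "t < 1"
  shows "(1 - t) *\<^sub>R x + t *\<^sub>R y \<in> dom h"
    and "real_of_ereal (h ((1 - t) *\<^sub>R x + t *\<^sub>R y))
           \<le> (1 - t) * real_of_ereal (h x) + t * real_of_ereal (h y)"
proof -
  let ?z = "(1 - t) *\<^sub>R x + t *\<^sub>R y"
  have "h ?z \<le> ereal (1 - t) * h x + ereal t * h y"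
    using assms unfolding convex_fun_def by blast
  also have "\<dots> = ereal ((1 - t) * real_of_ereal (h x) + t * real_of_ereal (h y))"
    by (subst proper_real[OF assms(1,3)], subst proper_real[OF assms(1,4)]) simp
  finally have le: "h ?z \<le> \<dots>" .
  then show z: "?z \<in> dom h"
    unfolding dom_def by (auto intro: le_less_trans)
  show "real_of_ereal (h ?z) \<le> (1 - t) * real_of_ereal (h x) + t * real_of_ereal (h y)"
    using le by (subst (asm) proper_real[OF assms(1) z]) simp
qed

text \<open>Lower semicontinuity bounds \<open>h\<close> below on a small ball around a point
  \<open>z0\<close> of its domain, and convexity along rays from \<open>z0\<close> turns this into a
  bound of linear decay. The resulting cone does the work of an affine minorant: a quadratic penalty
  dominates it.\<close>

lemma convex_lsc_minorant:
  fixes h :: "'a::real_normed_vector \<Rightarrow> ereal"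
  assumes "proper h" "lower_semicontinuous h" "convex_fun h"
  obtains a c z0 where "a \<ge> 0" "\<And>z. z \<in> dom h \<Longrightarrow> c - a * norm (z - z0) \<le> real_of_ereal (h z)"
proof -
  obtain z0 where z0: "z0 \<in> dom h"
    using assms(1) unfolding proper_def by blast
  define H where "H = (\<lambda>z. real_of_ereal (h z))"
  have hH: "h z = ereal (H z)" if "z \<in> dom h" for z
    unfolding H_def by (rule proper_real[OF assms(1) that])
  have "ereal (H z0 - 1) < h z0"
    using hH[OF z0] by simp
  from lower_semicontinuous_nhds[OF assms(2) this]
  obtain e where "e > 0" and e: "\<And>z. dist z z0 < e \<Longrightarrow> ereal (H z0 - 1) < h z"
    unfolding eventually_nhds_metric by blast
  define r where "r = e / 2"
  have r: "r > 0" using \<open>e > 0\<close> by (simp add: r_def)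
  have near: "H z0 - 1 < H z" if "z \<in> dom h" "norm (z - z0) \<le> r" for z
    using e[of z] that \<open>e > 0\<close> hH[OF that(1)] by (simp add: dist_norm r_def)
  have "(H z0 - 1) - (1 / r) * norm (z - z0) \<le> H z" if z: "z \<in> dom h" for z
  proof (cases "norm (z - z0) \<le> r")
    case True
    with near[OF z True] r show ?thesis
      by (smt (verit) divide_nonneg_pos mult_nonneg_nonneg norm_ge_zero)
  next
    case False
    \<comment> \<open>This \<open>t\<close> places \<open>?w\<close> at distance exactly
      \<open>r\<close> from \<open>z0\<close>, where the local bound \<open>near\<close> still
      holds.\<close>
    define t where "t = r / norm (z - z0)"
    have pos: "norm (z - z0) > 0"
      using False r by linarith
    have t: "0 < t" "t < 1"
      using False r pos unfolding t_def by (simp_all add: pos_divide_less_eq)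
    let ?w = "(1 - t) *\<^sub>R z0 + t *\<^sub>R z"
    have "?w - z0 = t *\<^sub>R (z - z0)"
      by (simp add: algebra_simps)
    then have "norm (?w - z0) = r"
      using pos r by (simp add: t_def)
    then have "H z0 - 1 < H ?w"
      using near[of ?w] convex_fun_real(1)[OF assms(1,3) z0 z t] by simp
    also have "\<dots> \<le> (1 - t) * H z0 + t * H z"
      unfolding H_def by (rule convex_fun_real(2)[OF assms(1,3) z0 z t])
    finally have "t * (H z0 - H z) < t * (1 / t)"
      using t by (simp add: algebra_simps)
    then have "H z0 - H z < 1 / t"
      using t(1) mult_less_cancel_left_pos by blast
    also have "1 / t = (1 / r) * norm (z - z0)"
      by (simp add: t_def)
    finally show ?thesis by simp
  qed
  then show thesis
    using that[of "1 / r" "H z0 - 1" z0] r unfolding H_def by simp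
qed

section \<open>Existence and uniqueness of proximal points\<close>

lemma le_zero_if_le_scaled:
  fixes a b :: real
  assumes "\<And>t. 0 < t \<Longrightarrow> t < 1 \<Longrightarrow> a \<le> t * b"
  shows "a \<le> 0"
proof (rule tendsto_lowerbound)
  show "((\<lambda>t. t * b) \<longlongrightarrow> 0) (at_right 0)"
    by (auto intro!: tendsto_eq_intros)
  show "\<forall>\<^sub>F t in at_right 0. a \<le> t * b"
    using eventually_at_right_less[of 0] eventually_at_right_real[of 0 1]
    by (auto elim: eventually_mono intro: assms)
qed simp

text \<open>
  The minimizer of \<open>h + \<parallel>\<cdot> - x\<parallel>\<^sup>2 / (2 \<alpha>)\<close> is the required point; by strong convexity, minimizing
  sequences are Cauchy.
\<close>

lemma resolvent_exists:
  fixes h :: "'a::{real_inner, complete_space} \<Rightarrow> ereal"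
  assumes h: "proper h" "lower_semicontinuous h" "convex_fun h" and \<alpha>: "\<alpha> > 0"
  shows "\<exists>z. (1 / \<alpha>) *\<^sub>R (x - z) \<in> subdifferential h z"
proof -
  define H where "H = (\<lambda>z. real_of_ereal (h z))"
  have hH: "h z = ereal (H z)" if "z \<in> dom h" for z
    unfolding H_def by (rule proper_real[OF h(1) that])
  define b where "b = 1 / (2 * \<alpha>)"
  have b: "b > 0" using \<alpha> by (simp add: b_def)
  define \<phi> where "\<phi> = (\<lambda>z. H z + b * (norm (z - x))\<^sup>2)"
  \<comment> \<open>Strong convexity: the squared norm satisfies the convexity inequality with an
    exact remainder, the identity \<open>quad\<close>.\<close>
  have \<phi>_conv: "\<phi> ((1 - t) *\<^sub>R u + t *\<^sub>R v) \<le> (1 - t) * \<phi> u + t * \<phi> v - b * t * (1 - t) * (norm (u - v))\<^sup>2"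
    if "u \<in> dom h" "v \<in> dom h" "0 < t" "t < 1" for t u v
  proof -
    have "H ((1 - t) *\<^sub>R u + t *\<^sub>R v) \<le> (1 - t) * H u + t * H v"
      unfolding H_def by (rule convex_fun_real(2)[OF h(1,3) that])
    moreover have quad: "(norm ((1 - t) *\<^sub>R u + t *\<^sub>R v - x))\<^sup>2 =
        (1 - t) * (norm (u - x))\<^sup>2 + t * (norm (v - x))\<^sup>2 - t * (1 - t) * (norm (u - v))\<^sup>2"
      unfolding power2_norm_eq_inner
      by (simp add: inner_diff_left inner_diff_right inner_add_left inner_add_right
          inner_commute[of v u] inner_commute[of x u] inner_commute[of x v]) algebra
    ultimately show ?thesis
      unfolding \<phi>_def quad by (simp add: algebra_simps)
  qed
  obtain a c z0 where a: "a \<ge> 0" and minor: "\<And>z. z \<in> dom h \<Longrightarrow> c - a * norm (z - z0) \<le> H z"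
    using convex_lsc_minorant[OF h] unfolding H_def by metis
  \<comment> \<open>Completing the square absorbs the linear decay of the minorant into the
    quadratic term, so that the infimum of \<open>\<phi>\<close> is finite.\<close>
  have lower: "c - a * norm (x - z0) - a\<^sup>2 / (4 * b) \<le> \<phi> z" if "z \<in> dom h" for z
  proof -
    have "a * norm (z - z0) \<le> a * (norm (z - x) + norm (x - z0))"
      using a by (intro mult_left_mono) (metis norm_triangle_ineq diff_add_cancel add_diff_eq)
    moreover have "b * (norm (z - x) - a / (2 * b))\<^sup>2 =
        b * (norm (z - x))\<^sup>2 - a * norm (z - x) + a\<^sup>2 / (4 * b)"
      using b by (simp add: power2_eq_square field_simps)
    then have "a * norm (z - x) \<le> b * (norm (z - x))\<^sup>2 + a\<^sup>2 / (4 * b)"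
      using b mult_nonneg_nonneg[of b "(norm (z - x) - a / (2 * b))\<^sup>2"] by simp
    ultimately show ?thesis
      using minor[OF that] unfolding \<phi>_def by (simp add: algebra_simps)
  qed
  then have bdd: "bdd_below (\<phi> ` dom h)"
    by (meson bdd_belowI2)
  have ne: "dom h \<noteq> {}"
    using h(1) unfolding proper_def by blast
  define m where "m = Inf (\<phi> ` dom h)"
  have m_le: "m \<le> \<phi> z" if "z \<in> dom h" for z
    unfolding m_def using bdd that by (rule cINF_lower)
  have "\<exists>z\<in>dom h. \<phi> z < m + 1 / real (Suc n)" for n
    using cINF_less_iff[OF ne bdd, of "m + 1 / real (Suc n)"] unfolding m_def by simp
  then obtain s where s: "\<And>n. s n \<in> dom h" "\<And>n. \<phi> (s n) < m + 1 / real (Suc n)"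
    by metis
  \<comment> \<open>The midpoint of two almost minimal points has value at least \<open>m\<close>;
    strong convexity at \<open>1/2\<close> therefore forces the points together.\<close>
  have dist_s: "b * (norm (s i - s j))\<^sup>2 \<le> 4 / real (Suc n)" if "n \<le> i" "n \<le> j" for i j n
  proof -
    have "m \<le> \<phi> ((1 - 1/2) *\<^sub>R s i + (1/2) *\<^sub>R s j)"
      by (intro m_le convex_fun_real(1)[OF h(1,3)] s) auto
    also have "\<dots> \<le> (1 - 1/2) * \<phi> (s i) + (1/2) * \<phi> (s j) - b * (1/2) * (1 - 1/2) * (norm (s i - s j))\<^sup>2"
      by (intro \<phi>_conv s) auto
    finally have "b * (norm (s i - s j))\<^sup>2 \<le> 2 * (\<phi> (s i) + \<phi> (s j) - 2 * m)"
      by simp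
    moreover have "1 / real (Suc i) \<le> 1 / real (Suc n)" "1 / real (Suc j) \<le> 1 / real (Suc n)"
      using that by (auto intro!: divide_left_mono)
    then have "\<phi> (s i) \<le> m + 1 / real (Suc n)" "\<phi> (s j) \<le> m + 1 / real (Suc n)"
      using s(2)[of i] s(2)[of j] by (meson add_left_mono less_imp_le order_trans)+
    ultimately show ?thesis by simp
  qed
  have "Cauchy s"
  proof (rule metric_CauchyI)
    fix e :: real assume "e > 0"
    obtain n where n: "4 / (b * e\<^sup>2) < real n"
      using reals_Archimedean2 by blast
    have "dist (s i) (s j) < e" if "n \<le> i" "n \<le> j" for i j
    proof -
      have "4 < real n * (b * e\<^sup>2)"
        using n b \<open>e > 0\<close> by (simp add: pos_divide_less_eq)
      also have "\<dots> \<le> real (Suc n) * (b * e\<^sup>2)"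
        using b by (intro mult_right_mono) auto
      finally have "4 / real (Suc n) < b * e\<^sup>2"
        by (simp add: pos_divide_less_eq mult.commute)
      with dist_s[OF that] have "b * (norm (s i - s j))\<^sup>2 < b * e\<^sup>2"
        by linarith
      then have "(norm (s i - s j))\<^sup>2 < e\<^sup>2"
        using b by simp
      then show ?thesis
        unfolding dist_norm using \<open>e > 0\<close> by (meson less_imp_le power_less_imp_less_base)
    qed
    then show "\<exists>M. \<forall>i\<ge>M. \<forall>j\<ge>M. dist (s i) (s j) < e" by blast
  qed
  then obtain z where z: "s \<longlonglongrightarrow> z"
    using Cauchy_convergent_iff convergent_def by blast
  \<comment> \<open>Testing with real \<open>C\<close> below \<open>h z\<close> avoids presupposing
    that \<open>h z\<close> is finite; finiteness follows once all such \<open>C\<close> are bounded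
    by the same real number.\<close>
  have le_m: "C \<le> m - b * (norm (z - x))\<^sup>2" if "ereal C < h z" for C
  proof (rule tendsto_lowerbound)
    show "(\<lambda>n. m + 1 / real (Suc n) - b * (norm (s n - x))\<^sup>2) \<longlonglongrightarrow> m - b * (norm (z - x))\<^sup>2"
      by (rule tendsto_eq_intros z LIMSEQ_Suc[OF lim_1_over_n] | simp)+
    have "\<forall>\<^sub>F n in sequentially. ereal C < h (s n)"
      using lower_semicontinuous_nhds[OF h(2) that] z by (rule eventually_compose_filterlim)
    then show "\<forall>\<^sub>F n in sequentially. C \<le> m + 1 / real (Suc n) - b * (norm (s n - x))\<^sup>2"
    proof eventually_elim
      case (elim n)
      then have "C < H (s n)"
        using hH[OF s(1)] by simp
      with s(2)[of n] show ?case unfolding \<phi>_def by linarith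
    qed
  qed simp
  have hz: "h z \<le> ereal (m - b * (norm (z - x))\<^sup>2)"
    using le_m by (metis ereal_dense3 ereal_less_eq(3) linorder_not_le)
  then have zd: "z \<in> dom h"
    unfolding dom_def by (auto intro: le_less_trans)
  have \<phi>z: "\<phi> z \<le> m"
    using hz hH[OF zd] unfolding \<phi>_def by simp
  have key: "H z + inner ((1 / \<alpha>) *\<^sub>R (x - z)) (y - z) \<le> H y" if y: "y \<in> dom h" for y
  proof -
    \<comment> \<open>Comparing \<open>z\<close> with points of the segment towards
      \<open>y\<close>, dividing by \<open>t\<close> and letting \<open>t\<close> tend to
      \<open>0\<close> gives quadratic growth of \<open>\<phi>\<close> around \<open>z\<close>, with
      the full constant \<open>b\<close>.\<close>
    have "\<phi> z + b * (norm (z - y))\<^sup>2 - \<phi> y \<le> t * (b * (norm (z - y))\<^sup>2)" if t: "0 < t" "t < 1" for t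
    proof -
      have "\<phi> z \<le> \<phi> ((1 - t) *\<^sub>R z + t *\<^sub>R y)"
        using \<phi>z m_le[OF convex_fun_real(1)[OF h(1,3) zd y t]] by linarith
      also have "\<dots> \<le> (1 - t) * \<phi> z + t * \<phi> y - b * t * (1 - t) * (norm (z - y))\<^sup>2"
        by (rule \<phi>_conv[OF zd y t])
      finally have "t * (\<phi> z + b * (norm (z - y))\<^sup>2 - \<phi> y) \<le> t * (t * (b * (norm (z - y))\<^sup>2))"
        by (simp add: algebra_simps)
      then show ?thesis using t(1) by simp
    qed
    from le_zero_if_le_scaled[OF this]
    have 1: "\<phi> z + b * (norm (z - y))\<^sup>2 \<le> \<phi> y" by simp
    \<comment> \<open>The growth term cancels the square of \<open>norm (z - y)\<close> in this
      identity, which leaves exactly the linear term of the subgradient inequality.\<close>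
    have "(norm (y - x))\<^sup>2 - (norm (z - x))\<^sup>2 - (norm (z - y))\<^sup>2 = - (2 * inner (x - z) (y - z))"
      unfolding power2_norm_eq_inner
      by (simp add: inner_diff_left inner_diff_right inner_commute)
    then have "b * (norm (y - x))\<^sup>2 - b * (norm (z - x))\<^sup>2 - b * (norm (z - y))\<^sup>2 = b * - (2 * inner (x - z) (y - z))"
      by (metis right_diff_distrib)
    also have "\<dots> = - inner ((1 / \<alpha>) *\<^sub>R (x - z)) (y - z)"
      by (simp add: b_def)
    finally show ?thesis
      using 1 unfolding \<phi>_def by simp
  qed
  have "h z + ereal (inner ((1 / \<alpha>) *\<^sub>R (x - z)) (y - z)) \<le> h y" for y
  proof (cases "y \<in> dom h")
    case True
    then show ?thesis using key[OF True] hH[OF True] hH[OF zd] by simp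
  next
    case False
    then show ?thesis by (simp add: dom_def)
  qed
  then show ?thesis
    unfolding subdifferential_def by blast
qed

lemma subdifferential_dom:
  assumes "proper h" "v \<in> subdifferential h z"
  shows "z \<in> dom h"
proof -
  obtain y where "y \<in> dom h"
    using assms(1) unfolding proper_def by blast
  moreover have "h z + ereal (inner v (y - z)) \<le> h y"
    using assms(2) unfolding subdifferential_def by blast
  ultimately show ?thesis
    unfolding dom_def by (cases "h z") auto
qed

lemma subdifferential_real:
  assumes "proper h" "v \<in> subdifferential h z" "y \<in> dom h"
  shows "real_of_ereal (h z) + inner v (y - z) \<le> real_of_ereal (h y)"
proof -
  have "h z + ereal (inner v (y - z)) \<le> h y"
    using assms(2) unfolding subdifferential_def by blast
  moreover have "h z = ereal (real_of_ereal (h z))" "h y = ereal (real_of_ereal (h y))"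
    using proper_real[OF assms(1)] subdifferential_dom[OF assms(1,2)] assms(3) by blast+
  ultimately show ?thesis
    by (metis ereal_less_eq(3) plus_ereal.simps(1))
qed

text \<open>The sum of the subgradient inequalities at \<open>y\<close> and \<open>z\<close>; it
  provides uniqueness of proximal points.\<close>

lemma subdifferential_monotone:
  assumes "proper h" "u \<in> subdifferential h y" "v \<in> subdifferential h z"
  shows "inner (u - v) (y - z) \<ge> 0"
proof -
  have "real_of_ereal (h y) + inner u (z - y) \<le> real_of_ereal (h z)"
    "real_of_ereal (h z) + inner v (y - z) \<le> real_of_ereal (h y)"
    using assms subdifferential_real subdifferential_dom by blast+
  then show ?thesis
    by (simp add: inner_diff_left inner_diff_right)
qed

text \<open>This justifies the definite description in \<open>prox\<close>: existence is
  \<open>resolvent_exists\<close>, and two solutions coincide because their subgradients differ by a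
  negative multiple of \<open>y - z\<close>, against monotonicity.\<close>

lemma prox_subdifferential:
  fixes h :: "'a::{real_inner, complete_space} \<Rightarrow> ereal"
  assumes h: "proper h" "lower_semicontinuous h" "convex_fun h" and \<alpha>: "\<alpha> > 0"
  shows "(1 / \<alpha>) *\<^sub>R (x - prox \<alpha> h x) \<in> subdifferential h (prox \<alpha> h x)"
proof -
  have iff: "x \<in> (\<lambda>v. z + \<alpha> *\<^sub>R v) ` subdifferential h z \<longleftrightarrow>
      (1 / \<alpha>) *\<^sub>R (x - z) \<in> subdifferential h z" for z
  proof
    assume "(1 / \<alpha>) *\<^sub>R (x - z) \<in> subdifferential h z"
    moreover have "x = z + \<alpha> *\<^sub>R ((1 / \<alpha>) *\<^sub>R (x - z))"
      using \<alpha> by simp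
    ultimately show "x \<in> (\<lambda>v. z + \<alpha> *\<^sub>R v) ` subdifferential h z"
      by blast
  qed (use \<alpha> in auto)
  have uniq: "y = z" if "(1 / \<alpha>) *\<^sub>R (x - y) \<in> subdifferential h y"
    "(1 / \<alpha>) *\<^sub>R (x - z) \<in> subdifferential h z" for y z
  proof -
    have "0 \<le> inner ((1 / \<alpha>) *\<^sub>R (x - y) - (1 / \<alpha>) *\<^sub>R (x - z)) (y - z)"
      by (rule subdifferential_monotone[OF h(1) that])
    also have "(1 / \<alpha>) *\<^sub>R (x - y) - (1 / \<alpha>) *\<^sub>R (x - z) = (- (1 / \<alpha>)) *\<^sub>R (y - z)"
      by (simp add: algebra_simps)
    finally have "(1 / \<alpha>) * inner (y - z) (y - z) \<le> 0"
      by simp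
    then have "inner (y - z) (y - z) \<le> 0"
      using \<alpha> by (simp add: divide_le_0_iff)
    then have "(norm (y - z))\<^sup>2 \<le> 0"
      by (simp only: power2_norm_eq_inner)
    then show ?thesis
      by simp
  qed
  have "\<exists>!z. (1 / \<alpha>) *\<^sub>R (x - z) \<in> subdifferential h z"
    using resolvent_exists[OF h \<alpha>] uniq by blast
  then show ?thesis
    unfolding prox_def iff by (rule theI')
qed

section \<open>Riesz representation and gradients\<close>

text \<open>The representing vector is minus the resolvent of the functional at \<open>0\<close>.\<close>

lemma riesz_representation:
  fixes L :: "'a::{real_inner, complete_space} \<Rightarrow> real"
  assumes "bounded_linear L"
  shows "\<exists>v. \<forall>y. L y = inner v y"
proof -
  interpret bounded_linear L by fact
  let ?h = "\<lambda>y. ereal (L y)"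
  have "proper ?h"
    by (auto simp: proper_def dom_def)
  moreover have "lower_semicontinuous ?h"
    unfolding lower_semicontinuous_def
  proof
    fix x
    have "(?h \<longlongrightarrow> ?h x) (at x)"
      by (intro tendsto_ereal tendsto tendsto_ident_at)
    \<comment> \<open>In the trivial space \<open>at x = bot\<close>, and then \<open>Liminf\<close>
      is the top element; otherwise it equals the limit.\<close>
    then show "?h x \<le> Liminf (at x) ?h"
      using lim_imp_Liminf[of "at x" ?h "?h x"] by (cases "at x = bot") (simp_all only: Liminf_bot top_greatest order_refl not_False_eq_True)
  qed
  moreover have "convex_fun ?h"
    by (simp add: convex_fun_def add scaleR)
  ultimately obtain z where "(1 / 1) *\<^sub>R (0 - z) \<in> subdifferential ?h z"
    using resolvent_exists[of ?h 1 0] by auto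
  then have sub: "L z + inner (- z) (y - z) \<le> L y" for y
    unfolding subdifferential_def by (simp add: inner_diff_right)
  have le: "inner (- z) y \<le> L y" for y
    using sub[of "z + y"] by (simp add: add)
  \<comment> \<open>Both sides are linear, so the inequality at \<open>- y\<close> is the reverse of
    the one at \<open>y\<close>.\<close>
  have "L y = inner (- z) y" for y
    using le[of y] le[of "- y"] scaleR[of "- 1" y] by simp
  then show ?thesis by blast
qed

lemma gderiv_unique:
  assumes "GDERIV p x :> u" "GDERIV p x :> v"
  shows "u = v"
proof -
  have "(\<lambda>y. inner y u) = (\<lambda>y. inner y v)"
    using assms unfolding gderiv_def by (rule has_derivative_unique)
  then have "inner (u - v) u = inner (u - v) v"
    by metis
  then have "inner (u - v) (u - v) = 0"
    by (simp add: inner_diff_right)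
  then show ?thesis by simp
qed

text \<open>Riesz representation supplies a vector for the derivative and uniqueness of derivatives
  makes the description in \<open>grad\<close> denote it.\<close>

lemma grad_GDERIV:
  fixes h :: "'a::{real_inner, complete_space} \<Rightarrow> ereal"
  assumes "(\<lambda>y. real_of_ereal (h y)) differentiable (at x)"
  shows "GDERIV (\<lambda>y. real_of_ereal (h y)) x :> grad h x"
proof -
  obtain L where L: "((\<lambda>y. real_of_ereal (h y)) has_derivative L) (at x)"
    using assms unfolding differentiable_def by blast
  obtain v where "\<forall>y. L y = inner v y"
    using riesz_representation[OF has_derivative_bounded_linear[OF L]] by blast
  then have "L = (\<lambda>y. inner y v)"
    by (auto simp: inner_commute)
  with L have "GDERIV (\<lambda>y. real_of_ereal (h y)) x :> v"
    unfolding gderiv_def by simp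
  moreover from this have "grad h x = v"
    unfolding grad_def by (blast intro: the_equality gderiv_unique)
  ultimately show ?thesis by simp
qed

text \<open>By convexity the difference quotients along the segment from \<open>x\<close> to
  \<open>y\<close> are at most the increment of \<open>h\<close>. Their limit as \<open>t\<close>
  decreases to \<open>0\<close> is the directional derivative.\<close>

lemma grad_inequality:
  fixes h :: "'a::{real_inner, complete_space} \<Rightarrow> ereal"
  assumes h: "proper h" "convex_fun h" and x: "x \<in> dom h" and y: "y \<in> dom h"
    and diff: "(\<lambda>y. real_of_ereal (h y)) differentiable (at x)"
  shows "real_of_ereal (h x) + inner (grad h x) (y - x) \<le> real_of_ereal (h y)"
proof -
  let ?H = "\<lambda>y. real_of_ereal (h y)"
  let ?q = "\<lambda>t. ?H (x + t *\<^sub>R (y - x))"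
  have "((\<lambda>t. x + t *\<^sub>R (y - x)) has_derivative (\<lambda>t. t *\<^sub>R (y - x))) (at 0)"
    by (auto intro!: derivative_eq_intros)
  moreover have "(?H has_derivative (\<lambda>d. inner d (grad h x))) (at (x + 0 *\<^sub>R (y - x)))"
    using grad_GDERIV[OF diff] unfolding gderiv_def by simp
  ultimately have "(?q has_derivative (\<lambda>t. inner (t *\<^sub>R (y - x)) (grad h x))) (at 0)"
    by (rule has_derivative_compose)
  then have "(?q has_real_derivative inner (grad h x) (y - x)) (at 0)"
    unfolding has_field_derivative_def
    by (rule has_derivative_eq_rhs) (auto simp: inner_commute)
  then have "((\<lambda>t. (?q t - ?q 0) / t) \<longlongrightarrow> inner (grad h x) (y - x)) (at_right 0)"
    unfolding has_field_derivative_iff by (auto intro: filterlim_mono simp: at_le)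
  moreover have "\<forall>\<^sub>F t in at_right 0. (?q t - ?q 0) / t \<le> ?H y - ?H x"
    using eventually_at_right_real[of 0 1, OF zero_less_one]
  proof eventually_elim
    case (elim t)
    then have t: "0 < t" "t < 1" by auto
    have "x + t *\<^sub>R (y - x) = (1 - t) *\<^sub>R x + t *\<^sub>R y"
      by (simp add: algebra_simps)
    then have "?q t - ?q 0 \<le> t * (?H y - ?H x)"
      using convex_fun_real(2)[OF h x y t] by (simp add: algebra_simps)
    then show ?case
      using t by (simp add: pos_divide_le_eq mult.commute)
  qed
  ultimately have "inner (grad h x) (y - x) \<le> ?H y - ?H x"
    by (intro tendsto_upperbound) auto
  then show ?thesis by simp
qed

section \<open>Decreasing summable sequences\<close>

text \<open>The block of indices from \<open>n div 2\<close> to \<open>n - 1\<close> has at least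
  \<open>n / 2\<close> terms, each at least \<open>a n\<close>, while its sum is a difference of
  partial sums and tends to \<open>0\<close>.\<close>

lemma decseq_summable_imp_tendsto_zero:
  fixes a :: "nat \<Rightarrow> real"
  assumes dec: "decseq a" and nonneg: "\<And>n. 0 \<le> a n" and sum: "summable a"
  shows "(\<lambda>n. real n * a n) \<longlonglongrightarrow> 0"
proof -
  define S where "S = (\<lambda>n. \<Sum>i<n. a i)"
  have S: "S \<longlonglongrightarrow> suminf a"
    unfolding S_def by (rule summable_LIMSEQ[OF sum])
  have "filterlim (\<lambda>n::nat. n div 2) sequentially sequentially"
    unfolding filterlim_at_top eventually_sequentially
    by (metis div_le_mono nonzero_mult_div_cancel_left zero_neq_numeral)
  from filterlim_compose[OF S this] have S2: "(\<lambda>n. S (n div 2)) \<longlonglongrightarrow> suminf a" .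
  have lim: "(\<lambda>n. 2 * (S n - S (n div 2))) \<longlonglongrightarrow> 0"
    using tendsto_mult[OF tendsto_const[of 2] tendsto_diff[OF S S2]] by simp
  have "real n * a n \<le> 2 * (S n - S (n div 2))" for n
  proof -
    have "S n - S (n div 2) = (\<Sum>i\<in>{n div 2..<n}. a i)"
      unfolding S_def lessThan_atLeast0 by (subst sum_diff_nat_ivl) auto
    also have "\<dots> \<ge> (\<Sum>i\<in>{n div 2..<n}. a n)"
      by (intro sum_mono decseqD[OF dec]) auto
    finally have "real (n - n div 2) * a n \<le> S n - S (n div 2)"
      by simp
    then have "2 * (real (n - n div 2) * a n) \<le> 2 * (S n - S (n div 2))"
      by simp
    moreover have "real n * a n \<le> (2 * real (n - n div 2)) * a n"
      by (intro mult_right_mono nonneg) linarith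
    ultimately show ?thesis by (simp only: mult.assoc)
  qed
  then show ?thesis
    using nonneg by (intro tendsto_sandwich[OF _ _ tendsto_const lim]) (auto intro!: always_eventually)
qed

section \<open>Convergence rate of the method\<close>

theorem theorem4p3:
  fixes f g :: "'a::{real_inner, complete_space} \<Rightarrow> ereal"
    and x :: "nat \<Rightarrow> 'a" and \<alpha>s :: "nat \<Rightarrow> real"
    and \<sigma> \<theta> \<delta> \<alpha> :: real
  assumes "assumption_A1 f g"
    and "assumption_A2 f g"
    and "\<sigma> > 0" and "0 < \<theta>" and "\<theta> < 1" and "0 < \<delta>" and "\<delta> < 1 / 2"
    and "method1 f g \<sigma> \<theta> \<delta> x \<alpha>s"
    and "minimizers (\<lambda>y. f y + g y) \<noteq> {}"
    and "\<alpha> > 0" and "\<forall>k. \<alpha>s k \<ge> \<alpha>"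
  shows "(\<forall>k\<ge>1. (f (x k) + g (x k)) - (INF y. f y + g y)
            \<le> ereal (1 / (2 * \<alpha>) * ((infdist (x 0) (minimizers (\<lambda>y. f y + g y)))\<^sup>2 / real k)))
       \<and> ((\<exists>B::'a set. finite B \<and> span B = UNIV) \<longrightarrow>
            (\<lambda>k. ereal (real k) * ((f (x k) + g (x k)) - (INF y. f y + g y))) \<longlonglongrightarrow> 0)"
proof -
  let ?S = "minimizers (\<lambda>y. f y + g y)"
  from assms(1) have f: "proper f" "convex_fun f"
    and g: "proper g" "lower_semicontinuous g" "convex_fun g"
    and sub: "dom g \<subseteq> dom f"
    unfolding assumption_A1_def by auto
  have diff: "(\<lambda>y. real_of_ereal (f y)) differentiable (at y)" if "y \<in> dom g" for y
    using assms(2) that unfolding assumption_A2_def frechet_differentiable_on_def by blast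
  \<comment> \<open>Since \<open>real_of_ereal\<close> sends \<open>\<infinity>\<close> to
    \<open>0\<close>, \<open>F\<close> is used only on \<open>dom g\<close>; \<open>xd\<close> and
    \<open>S_dom\<close> place the iterates and the minimizers there.\<close>
  define F where "F = (\<lambda>y. real_of_ereal (f y) + real_of_ereal (g y))"
  have F: "f y + g y = ereal (F y)" if "y \<in> dom g" for y
    using proper_real[OF f(1), of y] proper_real[OF g(1) that] sub that
    unfolding F_def by (metis plus_ereal.simps(1) subsetD)
  have \<alpha>s: "\<alpha>s k > 0" for k
    using assms(10,11) less_le_trans by blast
  \<comment> \<open>A result \<open>Some\<close> means that the loop ended, hence that its test
    fails at the returned step size.\<close>
  have search: "\<alpha>s k * norm (grad f (x (Suc k)) - grad f (x k)) \<le> \<delta> * norm (x (Suc k) - x k)" for k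
  proof -
    have "linesearch1 f g (x k) \<sigma> \<theta> \<delta> = Some (\<alpha>s k)" and xS: "x (Suc k) = J f g (x k) (\<alpha>s k)"
      using assms(8) unfolding method1_def by auto
    from while_option_stop[OF this(1)[unfolded linesearch1_def]] show ?thesis
      unfolding xS by simp
  qed
  \<comment> \<open>The optimality condition of the proximal step, with the gradient of
    \<open>f\<close> taken at the old iterate.\<close>
  have step: "(1 / \<alpha>s k) *\<^sub>R (x k - x (Suc k)) - grad f (x k) \<in> subdifferential g (x (Suc k))" for k
  proof -
    have xS: "x (Suc k) = prox (\<alpha>s k) g (x k - \<alpha>s k *\<^sub>R grad f (x k))"
      using assms(8) unfolding method1_def J_def by auto
    have "(1 / \<alpha>s k) *\<^sub>R (x k - x (Suc k)) - grad f (x k) =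
        (1 / \<alpha>s k) *\<^sub>R ((x k - \<alpha>s k *\<^sub>R grad f (x k)) - x (Suc k))"
      using \<alpha>s[of k] by (simp add: scaleR_diff_right)
    then show ?thesis
      unfolding xS using prox_subdifferential[OF g \<alpha>s] by metis
  qed
  have xd: "x k \<in> dom g" for k
  proof (cases k)
    case 0
    then show ?thesis using assms(8) unfolding method1_def by simp
  qed (use step subdifferential_dom[OF g(1)] in blast)
  have basic: "2 * \<alpha>s k * (F (x (Suc k)) - F y) \<le>
      (norm (x k - y))\<^sup>2 - (norm (x (Suc k) - y))\<^sup>2 - (1 - 2 * \<delta>) * (norm (x (Suc k) - x k))\<^sup>2"
    if y: "y \<in> dom g" for k y
  proof -
    let ?u = "x k" and ?v = "x (Suc k)" and ?a = "\<alpha>s k"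
    \<comment> \<open>The error that remains when the three inequalities are added: gradients of
      \<open>f\<close> occur at both iterates. Cauchy-Schwarz and \<open>search\<close> bound
      it.\<close>
    let ?e = "inner (grad f ?v - grad f ?u) (?u - ?v)"
    have 1: "real_of_ereal (g ?v) + inner ((1 / ?a) *\<^sub>R (?u - ?v) - grad f ?u) (y - ?v) \<le> real_of_ereal (g y)"
      by (rule subdifferential_real[OF g(1) step y])
    have 2: "real_of_ereal (f ?u) + inner (grad f ?u) (y - ?u) \<le> real_of_ereal (f y)"
      using sub y xd diff by (intro grad_inequality[OF f]) auto
    have 3: "real_of_ereal (f ?v) + inner (grad f ?v) (?u - ?v) \<le> real_of_ereal (f ?u)"
      using sub xd diff by (intro grad_inequality[OF f]) auto
    have "F ?v - F y \<le> - (1 / ?a) * inner (?u - ?v) (y - ?v) - ?e"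
    proof -
      have "inner ((1 / ?a) *\<^sub>R (?u - ?v) - grad f ?u) (y - ?v) =
          (1 / ?a) * inner (?u - ?v) (y - ?v) - inner (grad f ?u) (y - ?v)"
        by (simp only: inner_diff_left inner_scaleR_left)
      moreover have "?e = inner (grad f ?v) (?u - ?v) + inner (grad f ?u) (y - ?u) - inner (grad f ?u) (y - ?v)"
        by (simp add: inner_diff_left inner_diff_right)
      ultimately show ?thesis
        using 1 2 3 unfolding F_def by simp
    qed
    from mult_left_mono[OF this, of ?a]
    have 4: "?a * (F ?v - F y) \<le> - inner (?u - ?v) (y - ?v) - ?a * ?e"
      using \<alpha>s[of k] by (simp add: right_diff_distrib)
    have "\<bar>?e\<bar> \<le> norm (grad f ?v - grad f ?u) * norm (?u - ?v)"
      by (rule Cauchy_Schwarz_ineq2)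
    then have "?a * - ?e \<le> ?a * (norm (grad f ?v - grad f ?u) * norm (?u - ?v))"
      using \<alpha>s[of k] by (intro mult_left_mono) auto
    also have "\<dots> \<le> (\<delta> * norm (?v - ?u)) * norm (?u - ?v)"
      using mult_right_mono[OF search[of k] norm_ge_zero[of "?u - ?v"]] by (simp add: mult.assoc)
    also have "\<dots> = \<delta> * (norm (?v - ?u))\<^sup>2"
      by (simp add: power2_eq_square norm_minus_commute)
    finally have 5: "- (?a * ?e) \<le> \<delta> * (norm (?v - ?u))\<^sup>2"
      by simp
    \<comment> \<open>Doubling \<open>4\<close> and \<open>5\<close> and inserting this identity
      leaves the coefficient \<open>- 1 + 2 * \<delta>\<close> in front of the squared step
      length.\<close>
    have "- (2 * inner (?u - ?v) (y - ?v)) = (norm (?u - y))\<^sup>2 - (norm (?v - y))\<^sup>2 - (norm (?v - ?u))\<^sup>2"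
      unfolding power2_norm_eq_inner
      by (simp add: inner_diff_left inner_diff_right inner_commute)
    with 4 5 show ?thesis
      by (simp add: algebra_simps)
  qed
  have drop: "F (x (Suc k)) \<le> F (x k)" for k
  proof -
    have "0 \<le> (1 - 2 * \<delta>) * (norm (x (Suc k) - x k))\<^sup>2"
      using assms(7) by simp
    with basic[OF xd, of k k] have "2 * \<alpha>s k * (F (x (Suc k)) - F (x k)) \<le> - (norm (x (Suc k) - x k))\<^sup>2"
      by simp
    also have "\<dots> \<le> 0"
      by simp
    finally have "2 * \<alpha>s k * (F (x (Suc k)) - F (x k)) \<le> 0" .
    then show ?thesis
      using \<alpha>s[of k] by (simp add: mult_le_0_iff)
  qed
  then have dec: "decseq (\<lambda>k. F (x k))"
    by (rule decseq_SucI)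
  \<comment> \<open>The value of \<open>f + g\<close> at a minimizer is at most the finite number
    \<open>F (x 0)\<close>.\<close>
  have S_dom: "z \<in> dom g" if "z \<in> ?S" for z
  proof -
    have "f z + g z \<le> ereal (F (x 0))"
      using that F[OF xd[of 0]] unfolding minimizers_def by (metis (mono_tags) mem_Collect_eq)
    moreover have "f z \<noteq> -\<infinity>"
      using f(1) unfolding proper_def by blast
    ultimately show ?thesis
      unfolding dom_def by (cases "f z"; cases "g z") auto
  qed
  have S_le: "F z \<le> F y" if "z \<in> ?S" "y \<in> dom g" for z y
    using that(1) F[OF that(2)] F[OF S_dom[OF that(1)]] unfolding minimizers_def
    by (metis (mono_tags) ereal_less_eq(3) mem_Collect_eq)
  obtain z0 where z0: "z0 \<in> ?S"
    using assms(9) by blast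
  have INF: "(INF y. f y + g y) = ereal (F z0)"
  proof -
    have "(INF y. f y + g y) = f z0 + g z0"
      using z0 unfolding minimizers_def by (intro antisym INF_lower INF_greatest) auto
    then show ?thesis using F[OF S_dom[OF z0]] by simp
  qed
  define a where "a = (\<lambda>k. F (x k) - F z0)"
  have gap: "(f (x k) + g (x k)) - (INF y. f y + g y) = ereal (a k)" for k
    unfolding INF F[OF xd] a_def by simp
  have a_nonneg: "0 \<le> a k" for k
    unfolding a_def using S_le[OF z0 xd] by simp
  have a_dec: "decseq a"
    using dec unfolding a_def decseq_def by simp
  \<comment> \<open>Nonnegativity of the gaps permits replacing each step size by its lower bound
    \<open>\<alpha>\<close>. The sum starts at \<open>a 1\<close>, since \<open>basic\<close> bounds
    the gap after a step.\<close>
  have telescope: "2 * \<alpha> * (\<Sum>i<n. a (Suc i)) \<le> (norm (x 0 - z))\<^sup>2 - (norm (x n - z))\<^sup>2"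
    if z: "z \<in> ?S" for n z
  proof (induction n)
    case (Suc n)
    have "F z = F z0"
      using S_le[OF z S_dom[OF z0]] S_le[OF z0 S_dom[OF z]] by simp
    moreover have "0 \<le> (1 - 2 * \<delta>) * (norm (x (Suc n) - x n))\<^sup>2"
      using assms(7) by simp
    ultimately have "2 * \<alpha>s n * a (Suc n) \<le> (norm (x n - z))\<^sup>2 - (norm (x (Suc n) - z))\<^sup>2"
      using basic[OF S_dom[OF z], of n] unfolding a_def by simp
    moreover have "2 * \<alpha> * a (Suc n) \<le> 2 * \<alpha>s n * a (Suc n)"
      using assms(11) a_nonneg by (intro mult_right_mono) auto
    ultimately show ?case
      using Suc by (simp add: distrib_left)
  qed simp
  have bound: "a k \<le> 1 / (2 * \<alpha>) * ((infdist (x 0) ?S)\<^sup>2 / real k)" if "k \<ge> 1" for k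
  proof -
    \<comment> \<open>The square root makes the estimate a lower bound for all distances to
      minimizers, so that it passes to their infimum without a nearest minimizer.\<close>
    have "sqrt (2 * \<alpha> * real k * a k) \<le> dist (x 0) z" if z: "z \<in> ?S" for z
    proof -
      have "real k * a k = (\<Sum>i<k. a k)"
        by simp
      also have "\<dots> \<le> (\<Sum>i<k. a (Suc i))"
        by (intro sum_mono decseqD[OF a_dec]) auto
      finally have "2 * \<alpha> * (real k * a k) \<le> 2 * \<alpha> * (\<Sum>i<k. a (Suc i))"
        using assms(10) by (intro mult_left_mono) auto
      also have "\<dots> \<le> (dist (x 0) z)\<^sup>2"
        using telescope[OF z, of k] zero_le_power2[of "norm (x k - z)"] unfolding dist_norm by linarith
      finally show ?thesis
        by (intro real_le_lsqrt) (auto simp: mult.assoc)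
    qed
    then have "sqrt (2 * \<alpha> * real k * a k) \<le> infdist (x 0) ?S"
      unfolding infdist_notempty[OF assms(9)] using assms(9) by (intro cINF_greatest)
    then have "2 * \<alpha> * real k * a k \<le> (infdist (x 0) ?S)\<^sup>2"
      using sqrt_le_D by blast
    then show ?thesis
      using that assms(10) by (simp add: field_simps)
  qed
  have "summable (\<lambda>i. a (Suc i))"
  proof (rule bounded_imp_summable)
    fix n
    \<comment> \<open>The criterion for summability uses sums up to and including \<open>n\<close>,
      hence \<open>Suc n\<close> here.\<close>
    have "2 * \<alpha> * (\<Sum>i<Suc n. a (Suc i)) \<le> (norm (x 0 - z0))\<^sup>2"
      using telescope[OF z0, of "Suc n"] zero_le_power2[of "norm (x (Suc n) - z0)"] by linarith
    then show "(\<Sum>i\<le>n. a (Suc i)) \<le> (norm (x 0 - z0))\<^sup>2 / (2 * \<alpha>)"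
      unfolding lessThan_Suc_atMost using assms(10)
      by (simp add: pos_le_divide_eq mult.commute)
  qed (rule a_nonneg)
  then have "summable a"
    by (simp add: summable_Suc_iff)
  from decseq_summable_imp_tendsto_zero[OF a_dec a_nonneg this]
  have "(\<lambda>k. ereal (real k * a k)) \<longlonglongrightarrow> ereal 0"
    by (rule tendsto_ereal)
  then show ?thesis
    unfolding gap using bound by (simp add: zero_ereal_def)
qed

end
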